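(* Let $K$ be the distribution function of a probability measure on $([0,1],\mathcal{B}([0,1]))$, let $F\in\mathbb{F}_K$, $\overline F:=1-F$, $0\le\beta'<\gamma\le1$, and assume that (a) $K$ is locally Lipschitz continuous at $x$ with local Lipschitz constant $L(x)>0$ for all $x\in(0,1)$, and $L(x)\le C'x^{-\beta'}(1-x)^{-\beta'}$ for all $x\in(0,1)$ and some constant $C'>0$; (b) $\int_{-\infty}^0F(x)^{\gamma-\beta'}\,dx+\int_0^\infty\overline F(x)^{\gamma-\beta'}\,dx<\infty$. Assume $F(x)\in(0,1)$ for all $x\in\mathbb{R}$, and define the weight function $$\phi_{\gamma,F}(x):=F(x)^{-\gamma}\mathbf{1}_{(-\infty,0)}(x)+\overline F(x)^{-\gamma}\mathbf{1}_{[0,\infty)}(x),\qquad x\in\mathbb{R}.$$ Then the functional $\mathcal{L}=\mathcal{L}_K:\mathbb{F}_K\to\mathbb{R}$ is H\"older-$1$ continuous at $F$ with respect to $(\|\cdot\|_{\phi_{\gamma,F}},|\cdot|)$ and $\widehat{\mathbb{F}}$, i.e. for every sequence $(F_n)\subset\widehat{\mathbb{F}}$ with $\|F_n-F\|_{\phi_{\gamma,F}}\to0$ one has $$|\mathcal{L}(F_n)-\mathcal{L}(F)|=\mathcal{O}\big(\|F_n-F\|_{\phi_{\gamma,F}}\big).$$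
   Context: $\mathbb{F}_K$ is the class of all distribution functions $F$ on $\mathbb{R}$ with $\int_{-\infty}^\infty|x|\,dK(F(x))<\infty$, and the L-functional associated with $K$ is $\mathcal{L}(F)=\mathcal{L}_K(F):=\int_{-\infty}^\infty x\,dK(F(x))$, $F\in\mathbb{F}_K$. A weight function is a continuous function $\phi:\mathbb{R}\to\mathbb{R}_+$ which is bounded away from zero (i.e. $\phi(\cdot)\ge\varepsilon$ for some $\varepsilon>0$) and u-shaped (i.e. nonincreasing on $(-\infty,x_\phi]$ and nondecreasing on $[x_\phi,\infty)$ for some $x_\phi\in\mathbb{R}$). For a function $\psi$ on $\mathbb{R}$, $\|\psi\|_\phi:=\|\psi\phi\|_\infty=\sup_{x\in\mathbb{R}}|\psi(x)|\phi(x)$. $(X_i)_{i\in\mathbb{N}}$ is a sequence of identically distributed real random variables on a probability space $(\Omega,\mathcal{F},\mathbb{P})$ with distribution function $F$, $\widehat F_n=\frac1n\sum_{i=1}^n\mathbf{1}_{[X_i,\infty)}$ is the empirical distribution function, and $\widehat{\mathbb{F}}:=\bigcup_{n\in\mathbb{N}}\{\widehat F_n(\omega):\omega\in\Omega\}$. In particular every element of $\widehat{\mathbb{F}}$ is of the form $\frac1m\sum_{i=1}^m\mathbf{1}_{[x_i,\infty)}$ with $m\in\mathbb{N}$, $x_1,\dots,x_m\in\mathbb{R}$. The assumption $F(x)\in(0,1)$ for all $x\in\mathbb{R}$ is made without loss of generality: if $F$ reaches $0$ or $1$, then the weight function $\phi_{\gamma,F}$ can be modified in the obvious way.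
   Formalization: Membership of F in F_K additionally requires K(F(x)) → K(1) as x → +∞, i.e. K has no atom at 1 since F < 1; otherwise the claim is false (K a point mass at 1, F logistic: L(F)=0 while L(F_n) is the sample maximum). *)

theory Defs
  imports "HOL-Probability.Probability" "HOL-Library.Landau_Symbols"
begin

definition distribution_function :: "(real \<Rightarrow> real) \<Rightarrow> bool" where
  "distribution_function F \<longleftrightarrow> (\<exists>\<mu>. real_distribution \<mu> \<and> F = cdf \<mu>)"

(* Probability measures on the unit interval are represented as Borel probability measures
   on the real line concentrated on the unit interval, so that K is defined on all reals. *)
definition unit_distribution_function :: "(real \<Rightarrow> real) \<Rightarrow> bool" where
  "unit_distribution_function K \<longleftrightarrow>
     (\<exists>\<kappa>. real_distribution \<kappa> \<and> measure \<kappa> {0..1} = 1 \<and> K = cdf \<kappa>)"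

(* The class of F with finite integral of |x| against dK(F(x)). The measure dK(F(x)) is the
   Lebesgue-Stieltjes measure of the right-continuous nondecreasing function K o F. If K has
   an atom at 1 and F < 1 everywhere, K o F has the increment K 1 - K(1-) only at x = +oo,
   where |x| is infinite; such F are not in the class. The limit condition expresses this:
   interval_measure lives on the finite reals and would silently drop this increment.
   The condition always holds if F attains the value 1 or K is continuous at 1. *)
definition L_domain :: "(real \<Rightarrow> real) \<Rightarrow> (real \<Rightarrow> real) set" where
  "L_domain K = {F. distribution_function F
     \<and> (\<integral>\<^sup>+x. ennreal \<bar>x\<bar> \<partial>interval_measure (\<lambda>x. K (F x))) < \<infinity>
     \<and> ((\<lambda>x. K (F x)) \<longlongrightarrow> K 1) at_top}"

definition L_functional :: "(real \<Rightarrow> real) \<Rightarrow> (real \<Rightarrow> real) \<Rightarrow> real" where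
  "L_functional K F = (\<integral>x. x \<partial>interval_measure (\<lambda>x. K (F x)))"

(* Valued in ennreal because the supremum may be infinite. *)
definition weighted_norm :: "(real \<Rightarrow> real) \<Rightarrow> (real \<Rightarrow> real) \<Rightarrow> ennreal" where
  "weighted_norm \<phi> \<psi> = (SUP x. ennreal (\<bar>\<psi> x\<bar> * \<phi> x))"

definition phi_weight :: "real \<Rightarrow> (real \<Rightarrow> real) \<Rightarrow> real \<Rightarrow> real" where
  "phi_weight \<gamma> F x =
     F x powr (-\<gamma>) * indicator {..<0} x + (1 - F x) powr (-\<gamma>) * indicator {0..} x"

definition empirical_df :: "(nat \<Rightarrow> 'a \<Rightarrow> real) \<Rightarrow> nat \<Rightarrow> 'a \<Rightarrow> real \<Rightarrow> real" where
  "empirical_df X n \<omega> x = (\<Sum>i=1..n. indicator {X i \<omega>..} x) / real n"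

definition empirical_dfs :: "'a measure \<Rightarrow> (nat \<Rightarrow> 'a \<Rightarrow> real) \<Rightarrow> (real \<Rightarrow> real) set" where
  "empirical_dfs M X = (\<Union>n\<in>{1..}. {empirical_df X n \<omega> | \<omega>. \<omega> \<in> space M})"

(* The weighted norms tend to 0, hence are eventually finite, so enn2real affects only
   finitely many terms. *)
definition holder_1_continuous_at ::
  "((real \<Rightarrow> real) \<Rightarrow> real) \<Rightarrow> (real \<Rightarrow> real) \<Rightarrow> (real \<Rightarrow> real) \<Rightarrow> (real \<Rightarrow> real) set \<Rightarrow> bool" where
  "holder_1_continuous_at T F \<phi> S \<longleftrightarrow>
     (\<forall>G :: nat \<Rightarrow> real \<Rightarrow> real.
        (\<forall>n. G n \<in> S) \<longrightarrow>
        (\<lambda>n. weighted_norm \<phi> (\<lambda>x. G n x - F x)) \<longlonglongrightarrow> 0 \<longrightarrow>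
        (\<lambda>n. \<bar>T (G n) - T F\<bar>) \<in> O(\<lambda>n. enn2real (weighted_norm \<phi> (\<lambda>x. G n x - F x))))"

end

theory Submission
  imports Defs
begin

text \<open>
  For distribution functions \<open>F\<close> and \<open>G\<close>, integration by parts turns the difference of the
  L-functionals into \<open>\<L>(G) - \<L>(F) = \<integral> (K(F x) - K(G x)) dx\<close>; the values
  \<open>K 0\<close> and \<open>K 1\<close>, the limits of \<open>K \<circ> F\<close> and of \<open>K \<circ> G\<close> at both ends of the line, cancel
  (\<open>L_functional_diff\<close>). So it suffices to bound the integrand by a constant times \<open>r = \<parallel>G - F\<parallel>\<close> (the weighted norm) times an integrable function
  that does not depend on \<open>G\<close>.

  In the left tail the weight gives \<open>\<bar>G x - F x\<bar> \<le> r * F x powr \<gamma>\<close>. The slope of \<open>K\<close> at \<open>u\<close> is at most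
  a constant times \<open>u powr (-\<beta>)\<close>, and \<open>\<beta> < 1\<close> makes this singularity integrable. The increment of \<open>K\<close>
  between \<open>F x\<close> and \<open>G x\<close> is therefore at most a constant times
  \<open>F x powr (-\<beta>) * \<bar>G x - F x\<bar>\<close>, however small \<open>G x\<close> is: \<open>G\<close> may vanish where \<open>F\<close> does not, as
  every empirical distribution function does far to the left, and only the power of \<open>F x\<close> appears
  in the bound (\<open>endpoint_increment_bound\<close>). The product is \<open>r * F x powr (\<gamma> - \<beta>)\<close>, which is
  integrable by hypothesis. The right tail is the same estimate for \<open>u \<mapsto> K (1 - u)\<close>. Both
  need \<open>F\<close> and \<open>G\<close> to stay away from the opposite end of the unit interval, which holds once \<open>r\<close>
  is small because the weight is at least \<open>1\<close>.

  The right tail also needs \<open>K\<close> to be left-continuous at \<open>1\<close>; this is what the condition at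
  \<open>+\<infinity>\<close> in the domain of the functional says when \<open>F < 1\<close> (\<open>left_continuous_at_one\<close>).
\<close>

section \<open>Increments of a locally Lipschitz function\<close>

text \<open>
  A mean value inequality for a function \<open>K\<close> that need not be differentiable. The estimate with an
  additional \<open>\<epsilon> * (b - a)\<close> is additive over adjacent intervals and holds on all short intervals
  around a point, so the bisection principle extends it to the whole interval.
\<close>
lemma increment_le_of_local_lipschitz:
  fixes K H h L :: "real \<Rightarrow> real"
  assumes "a \<le> b"
    and lip: "\<And>x. a \<le> x \<Longrightarrow> x \<le> b \<Longrightarrow> \<exists>\<delta>>0. (L x)-lipschitz_on (ball x \<delta>) K"
    and der: "\<And>x. a \<le> x \<Longrightarrow> x \<le> b \<Longrightarrow> (H has_real_derivative h x) (at x)"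
    and le: "\<And>x. a \<le> x \<Longrightarrow> x \<le> b \<Longrightarrow> L x \<le> h x"
  shows "\<bar>K b - K a\<bar> \<le> H b - H a"
proof (rule field_le_epsilon)
  fix e :: real assume "e > 0"
  define \<epsilon> where "\<epsilon> = e / (b - a + 1)"
  have "\<epsilon> > 0" using \<open>e > 0\<close> \<open>a \<le> b\<close> by (simp add: \<epsilon>_def)
  from \<open>a \<le> b\<close> have "\<bar>K b - K a\<bar> \<le> (H b - H a) + \<epsilon> * (b - a)"
  proof (induction rule: Bolzano)
    case (trans u v w)
    then show ?case by (simp add: algebra_simps)
  next
    case (local x)
    obtain \<delta>1 where \<delta>1: "\<delta>1 > 0" "(L x)-lipschitz_on (ball x \<delta>1) K"
      using lip local by blast
    have "((\<lambda>y. (H y - H x) / (y - x)) \<longlongrightarrow> h x) (at x)"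
      using der local by (simp add: has_field_derivative_iff)
    then have "\<forall>\<^sub>F y in at x. dist ((H y - H x) / (y - x)) (h x) < \<epsilon>"
      using \<open>\<epsilon> > 0\<close> by (rule tendstoD)
    then obtain \<delta>2 where \<delta>2: "\<delta>2 > 0"
      and d2: "\<And>y. y \<noteq> x \<Longrightarrow> dist y x < \<delta>2 \<Longrightarrow> dist ((H y - H x) / (y - x)) (h x) < \<epsilon>"
      unfolding eventually_at by blast
    have K: "\<bar>K y - K x\<bar> \<le> h x * \<bar>y - x\<bar>" if "dist y x < \<delta>1" for y
    proof -
      have "\<bar>K y - K x\<bar> \<le> L x * \<bar>y - x\<bar>"
        using lipschitz_onD[OF \<delta>1(2), of y x] that \<delta>1(1) by (simp add: dist_real_def abs_minus_commute)
      also have "\<dots> \<le> h x * \<bar>y - x\<bar>" using le local by (simp add: mult_right_mono)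
      finally show ?thesis .
    qed
    have H: "h x - \<epsilon> \<le> (H y - H x) / (y - x)" if "y \<noteq> x" "dist y x < \<delta>2" for y
      using d2[OF that] by (auto simp: dist_real_def)
    have up: "\<bar>K v - K x\<bar> \<le> H v - H x + \<epsilon> * (v - x)" if "x \<le> v" "v - x < min \<delta>1 \<delta>2" for v
    proof (cases "v = x")
      case False
      then have "(h x - \<epsilon>) * (v - x) \<le> H v - H x"
        using H[of v] that by (simp add: dist_real_def pos_le_divide_eq)
      with K[of v] that show ?thesis by (simp add: dist_real_def algebra_simps)
    qed simp
    have down: "\<bar>K x - K u\<bar> \<le> H x - H u + \<epsilon> * (x - u)" if "u \<le> x" "x - u < min \<delta>1 \<delta>2" for u
    proof (cases "u = x")
      case False
      then have "H u - H x \<le> (h x - \<epsilon>) * (u - x)"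
        using H[of u] that by (simp add: dist_real_def neg_le_divide_eq)
      with K[of u] that show ?thesis by (simp add: dist_real_def algebra_simps)
    qed simp
    show ?case
    proof (intro exI[of _ "min \<delta>1 \<delta>2"] conjI allI impI)
      fix u v assume "u \<le> x \<and> x \<le> v \<and> v - u < min \<delta>1 \<delta>2"
      then show "\<bar>K v - K u\<bar> \<le> H v - H u + \<epsilon> * (v - u)"
        using up[of v] down[of u] by (simp add: algebra_simps)
    qed (use \<delta>1 \<delta>2 in simp)
  qed
  also have "\<epsilon> * (b - a) \<le> e"
    using \<open>e > 0\<close> \<open>a \<le> b\<close> by (simp add: \<epsilon>_def field_simps)
  finally show "\<bar>K b - K a\<bar> \<le> H b - H a + e" by simp
qed

text \<open>
  With \<open>t = q / p\<close> this says \<open>\<bar>t powr (1 - \<beta>) - 1\<bar> \<le> \<bar>t - 1\<bar>\<close>: the number \<open>t powr (1 - \<beta>)\<close> lies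
  between \<open>1\<close> and \<open>t\<close>.
\<close>
lemma powr_increment_le:
  fixes p q \<beta> :: real
  assumes "0 \<le> \<beta>" "\<beta> < 1" "0 < p" "0 \<le> q"
  shows "\<bar>q powr (1 - \<beta>) - p powr (1 - \<beta>)\<bar> \<le> p powr (-\<beta>) * \<bar>q - p\<bar>"
proof -
  have *: "u powr (1 - \<beta>) = u * u powr (-\<beta>)" if "0 \<le> u" for u :: real
    using powr_mult_base[OF that, of "-\<beta>"] by simp
  show ?thesis
  proof (cases "q \<ge> p")
    case ge: True
    have "q powr (-\<beta>) \<le> p powr (-\<beta>)"
      using ge assms by (intro powr_mono2') auto
    then have "q * q powr (-\<beta>) \<le> q * p powr (-\<beta>)" using assms by (intro mult_left_mono)
    moreover have "p powr (1 - \<beta>) \<le> q powr (1 - \<beta>)" using ge assms by (intro powr_mono2) auto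
    ultimately show ?thesis using ge assms by (simp add: * algebra_simps)
  next
    case lt: False
    have "q * p powr (-\<beta>) \<le> q * q powr (-\<beta>)"
    proof (cases "q = 0")
      case False
      then show ?thesis using lt assms by (intro mult_left_mono powr_mono2') auto
    qed simp
    moreover have "q powr (1 - \<beta>) \<le> p powr (1 - \<beta>)" using lt assms by (intro powr_mono2) auto
    ultimately show ?thesis using lt assms by (simp add: * algebra_simps)
  qed
qed

text \<open>
  The function \<open>H u = A / (1 - \<beta>) * u powr (1 - \<beta>)\<close> has derivative \<open>A * u powr (-\<beta>)\<close>, so it
  dominates the increments of \<open>K\<close> on \<open>(0, c]\<close>, and on \<open>[0, c]\<close> by continuity. The bound is
  asymmetric on purpose: only \<open>p\<close> has to be positive, and only the power of \<open>p\<close> occurs.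
\<close>
lemma endpoint_increment_bound:
  fixes K L :: "real \<Rightarrow> real"
  assumes \<beta>: "0 \<le> \<beta>" "\<beta> < 1" and A: "0 \<le> A"
    and lip: "\<And>u. 0 < u \<Longrightarrow> u \<le> c \<Longrightarrow> \<exists>\<delta>>0. (L u)-lipschitz_on (ball u \<delta>) K"
    and le: "\<And>u. 0 < u \<Longrightarrow> u \<le> c \<Longrightarrow> L u \<le> A * u powr (-\<beta>)"
    and cont: "(K \<longlongrightarrow> K 0) (at_right 0)"
    and p: "0 < p" "p \<le> c" and q: "0 \<le> q" "q \<le> c"
  shows "\<bar>K q - K p\<bar> \<le> A / (1 - \<beta>) * p powr (-\<beta>) * \<bar>q - p\<bar>"
proof -
  define H where "H u = A / (1 - \<beta>) * u powr (1 - \<beta>)" for u :: real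
  have pos: "\<bar>K t - K s\<bar> \<le> H t - H s" if "0 < s" "s \<le> t" "t \<le> c" for s t
  proof (rule increment_le_of_local_lipschitz[where L = L])
    fix u assume u: "s \<le> u" "u \<le> t"
    show "(H has_real_derivative A * u powr (-\<beta>)) (at u)"
      unfolding H_def using u that \<beta> by (auto intro!: derivative_eq_intros)
  qed (use that lip le in auto)
  have lim: "(H \<longlongrightarrow> H 0) (at_right 0)"
  proof -
    have "((\<lambda>u. u powr (1 - \<beta>)) \<longlongrightarrow> 0 powr (1 - \<beta>)) (at_right (0::real))"
      using \<beta> by (intro tendsto_powr') (auto intro: eventually_at_rightI[of 0 1])
    then show ?thesis unfolding H_def by (intro tendsto_mult tendsto_const)
  qed
  have incr: "\<bar>K t - K s\<bar> \<le> H t - H s" if "0 \<le> s" "s \<le> t" "t \<le> c" for s t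
  proof (cases "0 < s \<or> s = t")
    case False
    with that have "s = 0" "0 < t" by auto
    have "\<bar>K t - K 0\<bar> \<le> H t - H 0"
    proof (rule tendsto_le)
      show "((\<lambda>s. \<bar>K t - K s\<bar>) \<longlongrightarrow> \<bar>K t - K 0\<bar>) (at_right 0)"
        by (intro tendsto_intros cont)
      show "((\<lambda>s. H t - H s) \<longlongrightarrow> H t - H 0) (at_right 0)"
        by (intro tendsto_intros lim)
      show "\<forall>\<^sub>F s in at_right 0. \<bar>K t - K s\<bar> \<le> H t - H s"
        using \<open>0 < t\<close> \<open>t \<le> c\<close> by (intro eventually_at_rightI[of 0 t] pos) auto
    qed simp
    with \<open>s = 0\<close> show ?thesis by simp
  qed (use pos[OF _ that(2,3)] in auto)
  have "\<bar>K q - K p\<bar> \<le> \<bar>H q - H p\<bar>"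
    using incr[of p q] incr[of q p] p q by (cases "p \<le> q") auto
  also have "\<dots> = A / (1 - \<beta>) * \<bar>q powr (1 - \<beta>) - p powr (1 - \<beta>)\<bar>"
    unfolding H_def right_diff_distrib[symmetric] abs_mult using A \<beta> by simp
  also have "\<dots> \<le> A / (1 - \<beta>) * (p powr (-\<beta>) * \<bar>q - p\<bar>)"
    using A \<beta> p q by (intro mult_left_mono powr_increment_le) auto
  finally show ?thesis by (simp add: mult.assoc)
qed

text \<open>
  Away from \<open>1\<close> the factor \<open>(1 - u) powr (-\<beta>)\<close> is at most \<open>(1 - c) powr (-\<beta>)\<close>, which leaves the
  one-sided singularity at \<open>0\<close>. The weight \<open>p powr (-\<gamma>)\<close> then turns \<open>p powr (-\<beta>) * \<bar>q - p\<bar>\<close> into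
  \<open>r * p powr (\<gamma> - \<beta>)\<close>.
\<close>
lemma weighted_increment_bound:
  fixes K L :: "real \<Rightarrow> real"
  assumes \<beta>: "0 \<le> \<beta>" "\<beta> < 1" and C: "0 \<le> C"
    and lip: "\<And>u. 0 < u \<Longrightarrow> u < 1 \<Longrightarrow> \<exists>\<delta>>0. (L u)-lipschitz_on (ball u \<delta>) K"
    and le: "\<And>u. 0 < u \<Longrightarrow> u < 1 \<Longrightarrow> L u \<le> C * u powr (-\<beta>) * (1 - u) powr (-\<beta>)"
    and cont: "(K \<longlongrightarrow> K 0) (at_right 0)"
    and c: "c < 1" and p: "0 < p" "p \<le> c" and q: "0 \<le> q" "q \<le> c"
    and r: "\<bar>q - p\<bar> * p powr (-\<gamma>) \<le> r"
  shows "\<bar>K q - K p\<bar> \<le> C * (1 - c) powr (-\<beta>) / (1 - \<beta>) * r * p powr (\<gamma> - \<beta>)"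
proof -
  let ?A = "C * (1 - c) powr (-\<beta>)"
  have A: "L u \<le> ?A * u powr (-\<beta>)" if "0 < u" "u \<le> c" for u
  proof -
    have "L u \<le> C * u powr (-\<beta>) * (1 - u) powr (-\<beta>)" using le that c by auto
    also have "\<dots> \<le> C * u powr (-\<beta>) * (1 - c) powr (-\<beta>)"
      using that c C \<beta> by (intro mult_left_mono powr_mono2') auto
    finally show ?thesis by (simp add: mult_ac)
  qed
  have "\<bar>K q - K p\<bar> \<le> ?A / (1 - \<beta>) * p powr (-\<beta>) * \<bar>q - p\<bar>"
    by (rule endpoint_increment_bound[where L = L and c = c]) (use assms A in auto)
  also have "\<bar>q - p\<bar> \<le> r * p powr \<gamma>"
    using r p by (simp add: powr_minus field_simps)
  then have "?A / (1 - \<beta>) * p powr (-\<beta>) * \<bar>q - p\<bar> \<le> ?A / (1 - \<beta>) * p powr (-\<beta>) * (r * p powr \<gamma>)"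
    using \<beta> C by (intro mult_left_mono) auto
  also have "\<dots> = ?A / (1 - \<beta>) * r * p powr (\<gamma> - \<beta>)"
    by (simp add: powr_diff powr_minus field_simps)
  finally show ?thesis .
qed

lemma lipschitz_on_reflect:
  fixes K :: "real \<Rightarrow> real"
  assumes "C-lipschitz_on (ball (1 - u) \<delta>) K"
  shows "C-lipschitz_on (ball u \<delta>) (\<lambda>x. K (1 - x))"
proof (rule lipschitz_onI)
  fix x y assume "x \<in> ball u \<delta>" "y \<in> ball u \<delta>"
  then show "dist (K (1 - x)) (K (1 - y)) \<le> C * dist x y"
    using lipschitz_onD[OF assms, of "1 - x" "1 - y"] by (auto simp: dist_real_def abs_minus_commute)
qed (rule lipschitz_on_nonneg[OF assms])

section \<open>The mean of a Lebesgue-Stieltjes measure\<close>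

text \<open>
  Tonelli's theorem for the set of all \<open>(t, x)\<close> with \<open>0 \<le> t < x\<close>, whose section at \<open>x\<close> has length
  \<open>x\<close> if \<open>x \<ge> 0\<close>, and is empty otherwise. The left side is the integral of the positive part,
  since \<^const>\<open>ennreal\<close> maps negative numbers to \<open>0\<close>.
\<close>
lemma nn_integral_positive_part_tail:
  assumes "sigma_finite_measure \<mu>" and [measurable_cong]: "sets \<mu> = sets borel"
  shows "(\<integral>\<^sup>+x. ennreal x \<partial>\<mu>) = (\<integral>\<^sup>+t\<in>{0..}. emeasure \<mu> {t<..} \<partial>lborel)"
proof -
  interpret sigma_finite_measure \<mu> by fact
  interpret pair_sigma_finite \<mu> lborel ..
  have "(\<integral>\<^sup>+x. ennreal x \<partial>\<mu>) = (\<integral>\<^sup>+x. (\<integral>\<^sup>+t. indicator {(t, x). 0 \<le> t \<and> t < x} (t, x) \<partial>lborel) \<partial>\<mu>)"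
  proof (rule nn_integral_cong)
    fix x :: real
    have "(\<integral>\<^sup>+t. indicator {(t, x). 0 \<le> t \<and> t < x} (t, x) \<partial>lborel) = (\<integral>\<^sup>+t. indicator {0..<x} t \<partial>lborel)"
      by (intro nn_integral_cong) (auto split: split_indicator)
    then show "ennreal x = (\<integral>\<^sup>+t. indicator {(t, x). 0 \<le> t \<and> t < x} (t, x) \<partial>lborel)"
      by (cases "0 \<le> x") (auto simp: ennreal_neg)
  qed
  also have "\<dots> = (\<integral>\<^sup>+t. (\<integral>\<^sup>+x. indicator {(t, x). 0 \<le> t \<and> t < x} (t, x) \<partial>\<mu>) \<partial>lborel)"
    by (rule Fubini'[symmetric]) measurable
  also have "\<dots> = (\<integral>\<^sup>+t\<in>{0..}. emeasure \<mu> {t<..} \<partial>lborel)"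
  proof (rule nn_integral_cong)
    fix t :: real
    have "(\<integral>\<^sup>+x. indicator {(t, x). 0 \<le> t \<and> t < x} (t, x) \<partial>\<mu>) = (\<integral>\<^sup>+x. indicator {0..} t * indicator {t<..} x \<partial>\<mu>)"
      by (intro nn_integral_cong) (auto split: split_indicator)
    also have "\<dots> = indicator {0..} t * emeasure \<mu> {t<..}"
      by (subst nn_integral_cmult) auto
    finally show "(\<integral>\<^sup>+x. indicator {(t, x). 0 \<le> t \<and> t < x} (t, x) \<partial>\<mu>) = emeasure \<mu> {t<..} * indicator {0..} t"
      by (simp add: mult.commute)
  qed
  finally show ?thesis .
qed

lemma nn_integral_negative_part_tail:
  assumes "sigma_finite_measure \<mu>" and [measurable_cong]: "sets \<mu> = sets borel"
  shows "(\<integral>\<^sup>+x. ennreal (-x) \<partial>\<mu>) = (\<integral>\<^sup>+t\<in>{..<0}. emeasure \<mu> {..t} \<partial>lborel)"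
proof -
  interpret sigma_finite_measure \<mu> by fact
  interpret pair_sigma_finite \<mu> lborel ..
  have "(\<integral>\<^sup>+x. ennreal (-x) \<partial>\<mu>) = (\<integral>\<^sup>+x. (\<integral>\<^sup>+t. indicator {(t, x). x \<le> t \<and> t < 0} (t, x) \<partial>lborel) \<partial>\<mu>)"
  proof (rule nn_integral_cong)
    fix x :: real
    have "(\<integral>\<^sup>+t. indicator {(t, x). x \<le> t \<and> t < 0} (t, x) \<partial>lborel) = (\<integral>\<^sup>+t. indicator {x..<0} t \<partial>lborel)"
      by (intro nn_integral_cong) (auto split: split_indicator)
    then show "ennreal (-x) = (\<integral>\<^sup>+t. indicator {(t, x). x \<le> t \<and> t < 0} (t, x) \<partial>lborel)"
      by (cases "x \<le> 0") (auto simp: ennreal_neg)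
  qed
  also have "\<dots> = (\<integral>\<^sup>+t. (\<integral>\<^sup>+x. indicator {(t, x). x \<le> t \<and> t < 0} (t, x) \<partial>\<mu>) \<partial>lborel)"
    by (rule Fubini'[symmetric]) measurable
  also have "\<dots> = (\<integral>\<^sup>+t\<in>{..<0}. emeasure \<mu> {..t} \<partial>lborel)"
  proof (rule nn_integral_cong)
    fix t :: real
    have "(\<integral>\<^sup>+x. indicator {(t, x). x \<le> t \<and> t < 0} (t, x) \<partial>\<mu>) = (\<integral>\<^sup>+x. indicator {..<0} t * indicator {..t} x \<partial>\<mu>)"
      by (intro nn_integral_cong) (auto split: split_indicator)
    also have "\<dots> = indicator {..<0} t * emeasure \<mu> {..t}"
      by (subst nn_integral_cmult) auto
    finally show "(\<integral>\<^sup>+x. indicator {(t, x). x \<le> t \<and> t < 0} (t, x) \<partial>\<mu>) = emeasure \<mu> {..t} * indicator {..<0} t"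
      by (simp add: mult.commute)
  qed
  finally show ?thesis .
qed

text \<open>
  The measure depends only on the increments of \<open>\<Phi>\<close>, so a limit \<open>m\<close> at \<open>-\<infinity>\<close> reduces to the case of
  limit \<open>0\<close>.
\<close>
lemma emeasure_interval_measure_Iic_shift:
  fixes \<Phi> :: "real \<Rightarrow> real"
  assumes mono: "\<And>x y. x \<le> y \<Longrightarrow> \<Phi> x \<le> \<Phi> y"
    and rc: "\<And>a. continuous (at_right a) \<Phi>"
    and bot: "(\<Phi> \<longlongrightarrow> m) at_bot"
  shows "emeasure (interval_measure \<Phi>) {..x} = \<Phi> x - m"
proof -
  have "interval_measure \<Phi> = interval_measure (\<lambda>x. \<Phi> x - m)"
    by (simp add: interval_measure_def)
  moreover have "((\<lambda>x. \<Phi> x - m) \<longlongrightarrow> 0) at_bot"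
    using bot by (simp add: LIM_zero)
  ultimately show ?thesis
    using emeasure_interval_measure_Iic[of "\<lambda>x. \<Phi> x - m" x] mono rc
    by (simp add: continuous_diff)
qed

lemma emeasure_interval_measure_Ioi:
  fixes \<Phi> :: "real \<Rightarrow> real"
  assumes mono: "\<And>x y. x \<le> y \<Longrightarrow> \<Phi> x \<le> \<Phi> y"
    and rc: "\<And>a. continuous (at_right a) \<Phi>"
    and top: "(\<Phi> \<longlongrightarrow> M) at_top"
  shows "emeasure (interval_measure \<Phi>) {x<..} = M - \<Phi> x"
proof -
  have "(\<Union>i::nat. {x<..real i}) = {x<..}"
    by (auto intro: real_arch_simple)
  moreover have "(\<lambda>i. emeasure (interval_measure \<Phi>) {x<..real i}) \<longlonglongrightarrow> emeasure (interval_measure \<Phi>) (\<Union>i::nat. {x<..real i})"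
    by (intro Lim_emeasure_incseq) (auto simp: incseq_def)
  moreover have "(\<lambda>i. ennreal (\<Phi> (real i) - \<Phi> x)) \<longlonglongrightarrow> ennreal (M - \<Phi> x)"
    by (intro tendsto_intros tendsto_ennrealI top[THEN filterlim_compose] filterlim_real_sequentially)
  then have "(\<lambda>i. emeasure (interval_measure \<Phi>) {x<..real i}) \<longlonglongrightarrow> ennreal (M - \<Phi> x)"
  proof (rule Lim_transform_eventually)
    show "\<forall>\<^sub>F i in sequentially. ennreal (\<Phi> (real i) - \<Phi> x) = emeasure (interval_measure \<Phi>) {x<..real i}"
      by (rule eventually_sequentiallyI[of "nat \<lceil>x\<rceil>"]) (simp add: emeasure_interval_measure_Ioc mono rc)
  qed
  ultimately show ?thesis by (metis LIMSEQ_unique)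
qed

text \<open>
  Integration by parts in a form that treats both half-lines at once. The function \<open>D\<close> is
  \<open>M - \<Phi>\<close>, the mass to the right, on the nonnegative half-line, and \<open>m - \<Phi>\<close>, minus the mass to
  the left, on the negative one. Its positive and negative parts have the same integrals as those
  of the identity under the measure, so one of the two functions is integrable if and only if the
  other is. For two measures with the same limits \<open>m\<close> and \<open>M\<close>, the difference of the means only
  involves the difference of the two functions \<open>\<Phi>\<close>.
\<close>

context
  fixes \<Phi> D :: "real \<Rightarrow> real" and m M :: real
  assumes mono: "\<And>x y. x \<le> y \<Longrightarrow> \<Phi> x \<le> \<Phi> y"
    and rc: "\<And>a. continuous (at_right a) \<Phi>"
    and bot: "(\<Phi> \<longlongrightarrow> m) at_bot" and top: "(\<Phi> \<longlongrightarrow> M) at_top"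
    and D: "\<And>t. D t = (if 0 \<le> t then M else m) - \<Phi> t"
begin

lemma interval_measure_parts:
  shows "(\<integral>\<^sup>+x. ennreal x \<partial>interval_measure \<Phi>) = (\<integral>\<^sup>+t. ennreal (D t) \<partial>lborel)"
    and "(\<integral>\<^sup>+x. ennreal (-x) \<partial>interval_measure \<Phi>) = (\<integral>\<^sup>+t. ennreal (- D t) \<partial>lborel)"
proof -
  have m: "m \<le> \<Phi> t" for t
    using bot by (rule tendsto_upperbound) (auto simp: eventually_at_bot_linorder mono intro!: exI[of _ t])
  have M: "\<Phi> t \<le> M" for t
    using top by (rule tendsto_lowerbound) (auto simp: eventually_at_top_linorder mono intro!: exI[of _ t])
  have sf: "sigma_finite_measure (interval_measure \<Phi>)"
    by (intro sigma_finite_interval_measure mono rc)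
  show "(\<integral>\<^sup>+x. ennreal x \<partial>interval_measure \<Phi>) = (\<integral>\<^sup>+t. ennreal (D t) \<partial>lborel)"
    unfolding nn_integral_positive_part_tail[OF sf sets_interval_measure]
    by (intro nn_integral_cong)
       (auto simp: D emeasure_interval_measure_Ioi[OF mono rc top] m ennreal_neg split: split_indicator)
  show "(\<integral>\<^sup>+x. ennreal (-x) \<partial>interval_measure \<Phi>) = (\<integral>\<^sup>+t. ennreal (- D t) \<partial>lborel)"
    unfolding nn_integral_negative_part_tail[OF sf sets_interval_measure]
    by (intro nn_integral_cong)
       (auto simp: D emeasure_interval_measure_Iic_shift[OF mono rc bot] M ennreal_neg split: split_indicator)
qed

lemma interval_measure_mean:
  shows "integrable (interval_measure \<Phi>) (\<lambda>x. x) \<longleftrightarrow> integrable lborel D"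
    and "integrable lborel D \<Longrightarrow> (\<integral>x. x \<partial>interval_measure \<Phi>) = (\<integral>t. D t \<partial>lborel)"
proof -
  have "\<Phi> \<in> borel_measurable borel" by (intro borel_measurable_mono monoI mono)
  then have "D \<in> borel_measurable lborel" unfolding D[abs_def] by measurable
  then show iff: "integrable (interval_measure \<Phi>) (\<lambda>x. x) \<longleftrightarrow> integrable lborel D"
    unfolding real_integrable_def interval_measure_parts by simp
  show "(\<integral>x. x \<partial>interval_measure \<Phi>) = (\<integral>t. D t \<partial>lborel)" if "integrable lborel D"
    using that iff by (simp add: real_lebesgue_integral_def interval_measure_parts)
qed

end


section \<open>Distribution functions and their composition with K\<close>

lemma distribution_function_iff:
  "distribution_function F \<longleftrightarrow>
     mono F \<and> (\<forall>a. continuous (at_right a) F) \<and> (F \<longlongrightarrow> 0) at_bot \<and> (F \<longlongrightarrow> 1) at_top"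
proof
  assume "distribution_function F"
  then obtain \<mu> where "real_distribution \<mu>" and F: "F = cdf \<mu>"
    by (auto simp: distribution_function_def)
  then interpret real_distribution \<mu> by simp
  show "mono F \<and> (\<forall>a. continuous (at_right a) F) \<and> (F \<longlongrightarrow> 0) at_bot \<and> (F \<longlongrightarrow> 1) at_top"
    unfolding F using cdf_nondecreasing cdf_is_right_cont cdf_lim_at_bot cdf_lim_at_top_prob
    by (auto intro: monoI)
next
  assume *: "mono F \<and> (\<forall>a. continuous (at_right a) F) \<and> (F \<longlongrightarrow> 0) at_bot \<and> (F \<longlongrightarrow> 1) at_top"
  then have "real_distribution (interval_measure F)" "cdf (interval_measure F) = F"
    by (auto intro!: real_distribution_interval_measure cdf_interval_measure dest: monoD)
  then show "distribution_function F" by (metis distribution_function_def)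
qed

lemma distribution_function_bounds:
  assumes "distribution_function F"
  shows "0 \<le> F x" "F x \<le> 1"
proof -
  obtain \<mu> where "real_distribution \<mu>" "F = cdf \<mu>"
    using assms by (auto simp: distribution_function_def)
  then interpret real_distribution \<mu> by simp
  show "0 \<le> F x" "F x \<le> 1"
    using \<open>F = cdf \<mu>\<close> by (auto simp: cdf_nonneg cdf_bounded_prob)
qed

text \<open>
  An empirical distribution function is an average of unit steps, which are the distribution
  functions of point masses.
\<close>
lemma distribution_function_empirical_df:
  assumes "n \<ge> 1"
  shows "distribution_function (empirical_df X n \<omega>)"
proof -
  have unit_step: "distribution_function (indicator {a..})" for a :: real
  proof -
    interpret prob_space "return borel a" by (rule prob_space_return) simp
    have "real_distribution (return borel a)" by unfold_locales auto
    moreover have "cdf (return borel a) = indicator {a..}"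
      by (auto simp: fun_eq_iff cdf_def measure_return split: split_indicator)
    ultimately show ?thesis by (metis distribution_function_def)
  qed
  have eq: "empirical_df X n \<omega> = (\<lambda>x. (\<Sum>i=1..n. indicator {X i \<omega>..} x) / real n)"
    by (simp add: empirical_df_def fun_eq_iff)
  have "mono (empirical_df X n \<omega>)"
    unfolding eq using unit_step by (auto simp: distribution_function_iff mono_def intro!: divide_right_mono sum_mono)
  moreover have "continuous (at_right a) (empirical_df X n \<omega>)" for a
    unfolding eq using unit_step assms
    by (intro continuous_intros continuous_sum) (auto simp: distribution_function_iff)
  moreover have "(empirical_df X n \<omega> \<longlongrightarrow> (\<Sum>i=1..n. 0) / real n) at_bot"
    unfolding eq using unit_step assms by (intro tendsto_intros) (auto simp: distribution_function_iff)
  moreover have "(empirical_df X n \<omega> \<longlongrightarrow> (\<Sum>i=1..n. 1) / real n) at_top"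
    unfolding eq using unit_step assms by (intro tendsto_intros) (auto simp: distribution_function_iff)
  ultimately show ?thesis
    using assms by (simp add: distribution_function_iff)
qed

text \<open>
  Some \<open>F x < 1\<close> has \<open>K (F x)\<close> close to \<open>K 1\<close>, and monotonicity keeps \<open>K\<close> close to \<open>K 1\<close> on the whole
  interval from \<open>F x\<close> to \<open>1\<close>.
\<close>
lemma left_continuous_at_one:
  fixes K F :: "real \<Rightarrow> real"
  assumes "mono K" and lim: "((\<lambda>x. K (F x)) \<longlongrightarrow> K 1) at_top" and "\<And>x. F x < 1"
  shows "(K \<longlongrightarrow> K 1) (at_left 1)"
proof (rule order_tendstoI)
  fix a assume "a < K 1"
  then have "\<forall>\<^sub>F x in at_top. a < K (F x)" using lim by (rule order_tendstoD(1)[rotated])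
  then obtain x where x: "a < K (F x)" by (auto simp: eventually_at_top_linorder)
  show "\<forall>\<^sub>F u in at_left 1. a < K u"
  proof (rule eventually_at_leftI)
    fix u assume "u \<in> {F x<..<1}"
    then have "K (F x) \<le> K u" using monoD[OF \<open>mono K\<close>, of "F x" u] by simp
    with x show "a < K u" by simp
  qed (use assms(3) in simp)
next
  fix a assume "K 1 < a"
  show "\<forall>\<^sub>F u in at_left 1. K u < a"
  proof (rule eventually_at_leftI)
    fix u :: real assume "u \<in> {0<..<1}"
    then have "K u \<le> K 1" using monoD[OF \<open>mono K\<close>, of u 1] by simp
    with \<open>K 1 < a\<close> show "K u < a" by simp
  qed simp
qed

context
  fixes K :: "real \<Rightarrow> real"
  assumes mono: "mono K" and rc: "\<And>a. continuous (at_right a) K" and lc: "(K \<longlongrightarrow> K 1) (at_left 1)"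
begin

text \<open>
  One-sided continuity of \<open>K\<close> is enough here: a nondecreasing right-continuous \<open>F\<close> approaches \<open>F a\<close>
  from the right, the limit \<open>0\<close> from above and the limit \<open>1\<close> from below. The last two limits may be
  attained, as they are by empirical distribution functions, so continuity is used within the
  closed half-lines.
\<close>
lemma compose_distribution_function:
  assumes "distribution_function F"
  shows "x \<le> y \<Longrightarrow> K (F x) \<le> K (F y)" and "continuous (at_right a) (\<lambda>x. K (F x))"
    and "((\<lambda>x. K (F x)) \<longlongrightarrow> K 0) at_bot" and "((\<lambda>x. K (F x)) \<longlongrightarrow> K 1) at_top"
proof -
  have F: "mono F" "continuous (at_right a) F" "(F \<longlongrightarrow> 0) at_bot" "(F \<longlongrightarrow> 1) at_top"
    using assms by (auto simp: distribution_function_iff)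
  note bounds = distribution_function_bounds[OF assms]
  show "x \<le> y \<Longrightarrow> K (F x) \<le> K (F y)"
    by (intro monoD[OF mono] monoD[OF F(1)])
  have Ici: "continuous (at u within {u..}) K" for u
    using rc[of u] by (simp add: continuous_within at_within_Ici_at_right)
  have Iic: "continuous (at 1 within {..1}) K"
    using lc by (simp add: continuous_within at_within_Iic_at_left)
  show "continuous (at_right a) (\<lambda>x. K (F x))"
  proof (rule continuous_within_compose2[OF F(2)])
    have "F ` {a<..} \<subseteq> {F a..}" by (auto intro!: monoD[OF F(1)])
    then show "continuous (at (F a) within F ` {a<..}) K"
      by (rule continuous_within_subset[OF Ici])
  qed
  show "((\<lambda>x. K (F x)) \<longlongrightarrow> K 0) at_bot"
    using bounds by (intro continuous_within_tendsto_compose[OF Ici _ F(3)]) auto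
  show "((\<lambda>x. K (F x)) \<longlongrightarrow> K 1) at_top"
    using bounds by (intro continuous_within_tendsto_compose[OF Iic _ F(4)]) auto
qed

text \<open>
  The function \<open>?D G\<close>, whose integral is the L-functional at \<open>G\<close>, differs from \<open>?D F\<close> by
  \<open>K (F x) - K (G x)\<close>. This transfers integrability from \<open>F\<close> to \<open>G\<close>, so \<open>G\<close> lies in the domain of
  the functional as soon as that difference is integrable.
\<close>
lemma L_functional_diff:
  assumes F: "distribution_function F" and G: "distribution_function G"
    and intF: "integrable (interval_measure (\<lambda>x. K (F x))) (\<lambda>x. x)"
    and diff: "integrable lborel (\<lambda>x. K (F x) - K (G x))"
  shows "L_functional K G - L_functional K F = (\<integral>x. K (F x) - K (G x) \<partial>lborel)"
proof -
  let ?D = "\<lambda>F x. (if 0 \<le> x then K 1 else K 0) - K (F x)"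
  have mean: "integrable (interval_measure (\<lambda>x. K (F x))) (\<lambda>x. x) \<longleftrightarrow> integrable lborel (?D F)"
    "integrable lborel (?D F) \<Longrightarrow> L_functional K F = (\<integral>x. ?D F x \<partial>lborel)"
    if "distribution_function F" for F
    using interval_measure_mean[OF compose_distribution_function[OF that], where D = "?D F"]
    unfolding L_functional_def by auto
  have DF: "integrable lborel (?D F)"
    using intF mean(1)[OF F] by simp
  have "?D G = (\<lambda>x. ?D F x + (K (F x) - K (G x)))" by auto
  then have DG: "integrable lborel (?D G)"
    using Bochner_Integration.integrable_add[OF DF diff] by simp
  have "L_functional K G - L_functional K F = (\<integral>x. ?D G x \<partial>lborel) - (\<integral>x. ?D F x \<partial>lborel)"
    using mean(2)[OF F DF] mean(2)[OF G DG] by simp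
  also have "\<dots> = (\<integral>x. ?D G x - ?D F x \<partial>lborel)"
    by (rule Bochner_Integration.integral_diff[OF DG DF, symmetric])
  also have "\<dots> = (\<integral>x. K (F x) - K (G x) \<partial>lborel)"
    by (intro Bochner_Integration.integral_cong) auto
  finally show ?thesis .
qed

end

section \<open>The Lipschitz estimate\<close>

text \<open>
  The integrand \<open>K (F x) - K (G x)\<close> is bounded by \<open>B * r * w x\<close>, where \<open>w\<close> is the power of the tails
  that is assumed to be integrable; the integral of \<open>w\<close> enters the Lipschitz constant.
\<close>
lemma L_functional_lipschitz_at:
  fixes K F L :: "real \<Rightarrow> real" and \<beta> \<gamma> C :: real
  assumes K: "distribution_function K" and F: "F \<in> L_domain K"
    and \<beta>: "0 \<le> \<beta>" "\<beta> < 1" and C: "0 \<le> C"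
    and lip: "\<And>u. 0 < u \<Longrightarrow> u < 1 \<Longrightarrow> \<exists>\<delta>>0. (L u)-lipschitz_on (ball u \<delta>) K"
    and le: "\<And>u. 0 < u \<Longrightarrow> u < 1 \<Longrightarrow> L u \<le> C * u powr (-\<beta>) * (1 - u) powr (-\<beta>)"
    and tails: "(\<integral>\<^sup>+x\<in>{..0}. ennreal (F x powr (\<gamma> - \<beta>)) \<partial>lborel)
         + (\<integral>\<^sup>+x\<in>{0..}. ennreal ((1 - F x) powr (\<gamma> - \<beta>)) \<partial>lborel) < \<infinity>"
    and \<gamma>: "0 \<le> \<gamma>"
    and F01: "\<And>x. 0 < F x" "\<And>x. F x < 1"
  obtains \<delta> B where "0 < \<delta>"
    "\<And>G r. distribution_function G \<Longrightarrow> r \<le> \<delta> \<Longrightarrow> (\<And>x. \<bar>G x - F x\<bar> * phi_weight \<gamma> F x \<le> r) \<Longrightarrow>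
       \<bar>L_functional K G - L_functional K F\<bar> \<le> B * r"
proof -
  have monoK: "mono K" and rcK: "\<And>a. continuous (at_right a) K"
    using K by (auto simp: distribution_function_iff)
  have dF: "distribution_function F" and lim: "((\<lambda>x. K (F x)) \<longlongrightarrow> K 1) at_top"
    and fin: "(\<integral>\<^sup>+x. ennreal \<bar>x\<bar> \<partial>interval_measure (\<lambda>x. K (F x))) < \<infinity>"
    using F by (auto simp: L_domain_def)
  have lcK: "(K \<longlongrightarrow> K 1) (at_left 1)"
    using monoK lim F01(2) by (rule left_continuous_at_one)
  have monoF: "mono F" using dF by (simp add: distribution_function_iff)
  have [measurable]: "F \<in> borel_measurable borel" "K \<in> borel_measurable borel"
    using monoF monoK by (auto intro: borel_measurable_mono)
  have intF: "integrable (interval_measure (\<lambda>x. K (F x))) (\<lambda>x. x)"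
    using fin by (auto simp: integrable_iff_bounded)
  \<comment> \<open>In the left tail \<open>F x \<le> F 0 \<le> 1 - 2 * \<delta>\<close>, so a perturbation by at most \<open>\<delta>\<close> stays below
     \<open>1 - \<delta>\<close>; likewise for the survival functions in the right tail.\<close>
  define \<delta> where "\<delta> = min (F 0) (1 - F 0) / 2"
  define w where "w x = (if x < 0 then F x powr (\<gamma> - \<beta>) else (1 - F x) powr (\<gamma> - \<beta>))" for x
  define B where "B = C * \<delta> powr (-\<beta>) / (1 - \<beta>)"
  have \<delta>: "0 < \<delta>" "\<delta> \<le> F 0 / 2" "\<delta> \<le> (1 - F 0) / 2"
    using F01[of 0] by (auto simp: \<delta>_def)
  have [measurable]: "w \<in> borel_measurable borel" unfolding w_def by measurable
  have w: "integrable lborel w"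
  proof (rule integrableI_bounded)
    have "(\<integral>\<^sup>+x. ennreal (norm (w x)) \<partial>lborel)
      \<le> (\<integral>\<^sup>+x. ennreal (F x powr (\<gamma> - \<beta>)) * indicator {..0} x
              + ennreal ((1 - F x) powr (\<gamma> - \<beta>)) * indicator {0..} x \<partial>lborel)"
      by (intro nn_integral_mono) (auto simp: w_def split: split_indicator)
    also have "\<dots> = (\<integral>\<^sup>+x\<in>{..0}. ennreal (F x powr (\<gamma> - \<beta>)) \<partial>lborel)
         + (\<integral>\<^sup>+x\<in>{0..}. ennreal ((1 - F x) powr (\<gamma> - \<beta>)) \<partial>lborel)"
      by (intro nn_integral_add) auto
    finally show "(\<integral>\<^sup>+x. ennreal (norm (w x)) \<partial>lborel) < \<infinity>"
      using tails by (rule order_le_less_trans)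
  qed simp
  have pointwise: "\<bar>K (F x) - K (G x)\<bar> \<le> B * r * w x"
    if G: "distribution_function G" and r: "r \<le> \<delta>"
      and near: "\<And>x. \<bar>G x - F x\<bar> * phi_weight \<gamma> F x \<le> r" for G r x
  proof (cases "x < 0")
    case True
    have FG: "\<bar>G x - F x\<bar> * F x powr (-\<gamma>) \<le> r"
      using near[of x] True by (simp add: phi_weight_def)
    \<comment> \<open>The weight is at least \<open>1\<close>, so the weighted bound also controls the unweighted distance.\<close>
    have "\<bar>G x - F x\<bar> * 1 \<le> \<bar>G x - F x\<bar> * F x powr (-\<gamma>)"
      using F01[of x] \<gamma> by (intro mult_left_mono) (auto simp: powr_minus one_le_inverse powr_le1)
    with FG r have "\<bar>G x - F x\<bar> \<le> \<delta>" by simp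
    moreover have "F x \<le> F 0" using monoD[OF monoF, of x 0] True by simp
    ultimately have le_c: "F x \<le> 1 - \<delta>" "G x \<le> 1 - \<delta>"
      using \<delta> by (simp_all add: abs_le_iff)
    have "(K \<longlongrightarrow> K 0) (at_right 0)" using rcK[of 0] by (simp add: continuous_within)
    then have "\<bar>K (G x) - K (F x)\<bar> \<le> C * (1 - (1 - \<delta>)) powr (-\<beta>) / (1 - \<beta>) * r * F x powr (\<gamma> - \<beta>)"
      using \<delta> F01(1) distribution_function_bounds(1)[OF G] le_c
      by (intro weighted_increment_bound[where L = L, OF \<beta> C lip le _ _ _ _ _ _ FG]) simp_all
    then show ?thesis using True by (simp add: B_def w_def abs_minus_commute)
  next
    case False
    have FG: "\<bar>(1 - G x) - (1 - F x)\<bar> * (1 - F x) powr (-\<gamma>) \<le> r"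
      using near[of x] False by (simp add: phi_weight_def abs_minus_commute)
    have "\<bar>G x - F x\<bar> * 1 \<le> \<bar>G x - F x\<bar> * (1 - F x) powr (-\<gamma>)"
      using F01[of x] \<gamma> by (intro mult_left_mono) (auto simp: powr_minus one_le_inverse powr_le1)
    with FG r have "\<bar>G x - F x\<bar> \<le> \<delta>" by (simp add: abs_minus_commute)
    moreover have "F 0 \<le> F x" using monoD[OF monoF, of 0 x] False by simp
    ultimately have le_c: "1 - F x \<le> 1 - \<delta>" "1 - G x \<le> 1 - \<delta>"
      using \<delta> by (simp_all add: abs_le_iff)
    \<comment> \<open>The left tail estimate, applied to \<open>u \<mapsto> K (1 - u)\<close> and the survival functions.\<close>
    have left: "((\<lambda>u. K (1 - u)) \<longlongrightarrow> K (1 - 0)) (at_right 0)"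
    proof -
      have "filterlim (\<lambda>u::real. 1 - u) (at_left 1) (at_right 0)"
        unfolding filterlim_at
        by (auto intro!: tendsto_eq_intros eventually_at_rightI[of 0 1])
      then show ?thesis using lcK by (auto intro: filterlim_compose)
    qed
    have lip': "\<exists>\<delta>>0. (L (1 - u))-lipschitz_on (ball u \<delta>) (\<lambda>u. K (1 - u))" if "0 < u" "u < 1" for u
      using lip[of "1 - u"] that by (auto intro: lipschitz_on_reflect)
    have le': "L (1 - u) \<le> C * u powr (-\<beta>) * (1 - u) powr (-\<beta>)" if "0 < u" "u < 1" for u
      using le[of "1 - u"] that by (simp add: mult_ac)
    have "\<bar>K (1 - (1 - G x)) - K (1 - (1 - F x))\<bar>
        \<le> C * (1 - (1 - \<delta>)) powr (-\<beta>) / (1 - \<beta>) * r * (1 - F x) powr (\<gamma> - \<beta>)"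
      using \<delta> F01(2) distribution_function_bounds(2)[OF G] le_c
      by (intro weighted_increment_bound[where L = "\<lambda>u. L (1 - u)" and K = "\<lambda>u. K (1 - u)",
            OF \<beta> C lip' le' left _ _ _ _ _ FG]) simp_all
    then show ?thesis using False by (simp add: B_def w_def abs_minus_commute)
  qed
  show thesis
  proof (rule that[of \<delta> "B * (\<integral>x. w x \<partial>lborel)"])
    fix G r
    assume G: "distribution_function G" and r: "r \<le> \<delta>"
      and near: "\<And>x. \<bar>G x - F x\<bar> * phi_weight \<gamma> F x \<le> r"
    have [measurable]: "G \<in> borel_measurable borel"
      using G by (auto intro: borel_measurable_mono simp: distribution_function_iff)
    have dom: "integrable lborel (\<lambda>x. B * r * w x)" using w by simp
    have diff: "integrable lborel (\<lambda>x. K (F x) - K (G x))"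
    proof (rule Bochner_Integration.integrable_bound[OF dom])
      show "AE x in lborel. norm (K (F x) - K (G x)) \<le> norm (B * r * w x)"
        using pointwise[OF G r near] by (intro AE_I2) (auto intro: order_trans[OF _ abs_ge_self])
    qed measurable
    have "L_functional K G - L_functional K F = (\<integral>x. K (F x) - K (G x) \<partial>lborel)"
      by (rule L_functional_diff[OF monoK rcK lcK dF G intF diff])
    also have "\<bar>\<dots>\<bar> \<le> (\<integral>x. \<bar>K (F x) - K (G x)\<bar> \<partial>lborel)"
      by (rule integral_abs_bound)
    also have "\<dots> \<le> (\<integral>x. B * r * w x \<partial>lborel)"
      using diff dom pointwise[OF G r near] by (intro integral_mono) auto
    finally show "\<bar>L_functional K G - L_functional K F\<bar> \<le> B * (\<integral>x. w x \<partial>lborel) * r"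
      by (simp add: mult_ac)
  qed (use \<delta> in simp)
qed

lemma weighted_norm_upper:
  assumes "weighted_norm \<phi> \<psi> < \<infinity>"
  shows "\<bar>\<psi> x\<bar> * \<phi> x \<le> enn2real (weighted_norm \<phi> \<psi>)"
proof -
  have "ennreal (\<bar>\<psi> x\<bar> * \<phi> x) \<le> weighted_norm \<phi> \<psi>"
    unfolding weighted_norm_def by (rule SUP_upper) simp
  also have "\<dots> = ennreal (enn2real (weighted_norm \<phi> \<psi>))" using assms by simp
  finally show ?thesis by simp
qed

theorem lemma3p1:
  fixes K F L :: "real \<Rightarrow> real" and \<beta>' \<gamma> C' :: real
    and M :: "'a measure" and X :: "nat \<Rightarrow> 'a \<Rightarrow> real"
  assumes "prob_space M"
    and "\<And>i. i \<ge> 1 \<Longrightarrow> X i \<in> borel_measurable M"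
    and "\<And>i. i \<ge> 1 \<Longrightarrow> cdf (distr M borel (X i)) = F"
    and "unit_distribution_function K"
    and "F \<in> L_domain K"
    and "0 \<le> \<beta>'" "\<beta>' < \<gamma>" "\<gamma> \<le> 1"
    and "\<And>x. x \<in> {0<..<1} \<Longrightarrow> L x > 0 \<and> (\<exists>\<delta>>0. (L x)-lipschitz_on (ball x \<delta>) K)"
    and "C' > 0"
    and "\<And>x. x \<in> {0<..<1} \<Longrightarrow> L x \<le> C' * x powr (-\<beta>') * (1 - x) powr (-\<beta>')"
    and "(\<integral>\<^sup>+x\<in>{..0}. ennreal (F x powr (\<gamma> - \<beta>')) \<partial>lborel)
         + (\<integral>\<^sup>+x\<in>{0..}. ennreal ((1 - F x) powr (\<gamma> - \<beta>')) \<partial>lborel) < \<infinity>"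
    and "\<And>x. F x \<in> {0<..<1}"
  shows "holder_1_continuous_at (L_functional K) F (phi_weight \<gamma> F) (empirical_dfs M X)"
proof -
  obtain \<kappa> where "real_distribution \<kappa>" "K = cdf \<kappa>"
    using assms(4) by (auto simp: unit_distribution_function_def)
  then have K: "distribution_function K" by (auto simp: distribution_function_def)
  have lip: "\<exists>\<delta>>0. (L u)-lipschitz_on (ball u \<delta>) K" if "0 < u" "u < 1" for u
    using assms(9)[of u] that by simp
  have le: "L u \<le> C' * u powr (-\<beta>') * (1 - u) powr (-\<beta>')" if "0 < u" "u < 1" for u
    using assms(11)[of u] that by simp
  have const: "\<beta>' < 1" "0 \<le> C'" "0 \<le> \<gamma>"
    using assms(6-8,10) by auto
  have F01: "0 < F x" "F x < 1" for x
    using assms(13)[of x] by auto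
  obtain \<delta> B where "0 < \<delta>" and bound:
    "\<And>G r. distribution_function G \<Longrightarrow> r \<le> \<delta> \<Longrightarrow> (\<And>x. \<bar>G x - F x\<bar> * phi_weight \<gamma> F x \<le> r) \<Longrightarrow>
       \<bar>L_functional K G - L_functional K F\<bar> \<le> B * r"
    using L_functional_lipschitz_at[OF K assms(5) assms(6) const(1,2) lip le assms(12) const(3) F01]
    by blast
  show ?thesis
    unfolding holder_1_continuous_at_def
  proof (intro allI impI)
    fix G :: "nat \<Rightarrow> real \<Rightarrow> real"
    let ?r = "\<lambda>n. weighted_norm (phi_weight \<gamma> F) (\<lambda>x. G n x - F x)"
    assume S: "\<forall>n. G n \<in> empirical_dfs M X" and lim: "?r \<longlonglongrightarrow> 0"
    have G: "distribution_function (G n)" for n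
      using S[rule_format, of n] by (auto simp: empirical_dfs_def intro!: distribution_function_empirical_df)
    have "\<forall>\<^sub>F n in sequentially. ?r n < ennreal \<delta>"
      using lim \<open>0 < \<delta>\<close> by (intro order_tendstoD(2)) auto
    then have "\<forall>\<^sub>F n in sequentially.
        norm \<bar>L_functional K (G n) - L_functional K F\<bar> \<le> B * norm (enn2real (?r n))"
    proof eventually_elim
      case (elim n)
      then have fin: "?r n < \<infinity>" by (simp add: less_top order_less_trans)
      then have "enn2real (?r n) \<le> \<delta>"
        using elim \<open>0 < \<delta>\<close> by (intro enn2real_leI) auto
      then show ?case
        using bound[OF G _ weighted_norm_upper[OF fin]] by simp
    qed
    then show "(\<lambda>n. \<bar>L_functional K (G n) - L_functional K F\<bar>) \<in> O(\<lambda>n. enn2real (?r n))"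
      by (rule bigoI)
  qed
qed

end
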